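(* Let $g:\mathbb{R}^n\to\mathbb{R}^n$ be Lipschitz continuous with a constant $\kappa<1$, and let $g$ be differentiable at $x^*$, where $x^*$ is the fixed point of $g$. Let $\{x^k\}$ be generated by the regularized Anderson acceleration algorithm (LM-AA, described in the context) with stopping threshold $\epsilon_f=0$ and with the constant $c\in(0,1)$ chosen such that $c\ge\kappa$. Suppose that for the solutions $\bar\alpha^k\in\operatorname{argmin}_{\alpha}\|\hat f^k(\alpha)\|^2$ of the unregularized problem there exists $M>0$ such that $\|\bar\alpha^k\|_\infty\le M$ for all $k$ sufficiently large. Then the sequence $\{x^k\}$ either terminates after finitely many steps, or it converges to the fixed point $x^*$ and there exists some $\ell\in\mathbb{N}$ such that $\rho_k\ge p_2$ for all $k\ge\ell$. In particular (in the latter case), every iteration $k\ge\ell$ is successful with $x^{k+1}=\hat g^k(\alpha^k)$.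
   Context: $\|\cdot\|$ is the Euclidean norm on $\mathbb{R}^n$, and $f(x):=g(x)-x$. The solution $\bar\alpha^k$ of the unregularized problem need not be unique; $\bar\alpha^k$ denotes a chosen solution for each $k$. LM-AA algorithm. Input: a mapping $g:\mathbb{R}^n\to\mathbb{R}^n$ with residual $f(x)=g(x)-x$; a starting point $x^0\in\mathbb{R}^n$; a memory parameter $m\in\mathbb{N}$, $m\ge1$; constants $\mu_0>0$, $0<p_1<p_2<1$, $0<\eta_2<1<\eta_1$, $0<c<1$, $\gamma\in(0,\frac{1}{m+1})$. For $k=0,1,2,\dots$ perform the following steps. 1. Compute $g^k:=g(x^k)$ and $f^k:=f(x^k)=g^k-x^k$. With stopping threshold $\epsilon_f=0$: if $f^k=0$, terminate. 2. Let $m_k:=\min\{m,k\}$. Let $k_0$ be the largest index in $\{k,k-1,\dots,k-m_k\}$ at which $\|f^i\|$ is minimal over $i\in\{k,k-1,\dots,k-m_k\}$, and let $k_1,\dots,k_{m_k}$ be an enumeration of the remaining indices of $\{k,\dots,k-m_k\}$. 3. For $\alpha\in\mathbb{R}^{m_k}$ define $\hat f^k(\alpha):=f^{k_0}+\sum_{i=1}^{m_k}\alpha_i(f^{k_i}-f^{k_0})$ and $\hat g^k(\alpha):=g^{k_0}+\sum_{i=1}^{m_k}\alpha_i(g^{k_i}-g^{k_0})$ (for $k=0$ the sums are empty). 4. Set $\lambda_k:=\mu_k\|f^{k_0}\|^2$ and let $\alpha^k:=\operatorname{argmin}_{\alpha\in\mathbb{R}^{m_k}}\|\hat f^k(\alpha)\|^2+\lambda_k\|\alpha\|^2$.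 5. Set $r_k:=(1-m_k\gamma)\|f^{k_0}\|+\gamma\sum_{i=1}^{m_k}\|f^{k_i}\|$, $\mathrm{ared}_k:=r_k-\|f(\hat g^k(\alpha^k))\|$, $\mathrm{pred}_k:=r_k-c\|\hat f^k(\alpha^k)\|$, and $\rho_k:=\mathrm{ared}_k/\mathrm{pred}_k$. 6. Set $\mu_{k+1}:=\eta_1\mu_k$ if $\rho_k<p_1$; $\mu_{k+1}:=\mu_k$ if $\rho_k\in[p_1,p_2]$; $\mu_{k+1}:=\eta_2\mu_k$ if $\rho_k>p_2$. 7. If $\rho_k\ge p_1$ (successful iteration), set $x^{k+1}:=\hat g^k(\alpha^k)$; otherwise set $x^{k+1}:=g^{k_0}=g(x^{k_0})$. *)

theory Defs
  imports "HOL-Analysis.Analysis"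
begin

definition residual :: "(real^'n \<Rightarrow> real^'n) \<Rightarrow> real^'n \<Rightarrow> real^'n" where
  "residual g y = g y - y"

text \<open>
  Iterates are \<open>x :: nat \<Rightarrow> real^'n\<close>. The index \<open>k\<^sub>i\<close> of iteration \<open>k\<close> is \<open>idx k i\<close> for
  \<open>0 \<le> i \<le> m\<^sub>k\<close>. As \<open>m\<^sub>k\<close> varies with \<open>k\<close>, a vector of real numbers of length \<open>m\<^sub>k\<close> is an extensional function
  in \<open>{1..m\<^sub>k} \<rightarrow>\<^sub>E UNIV\<close>; for \<open>k = 0\<close> this set has exactly one element.
\<close>

definition mem_size :: "nat \<Rightarrow> nat \<Rightarrow> nat" where
  "mem_size m k = min m k"

definition window :: "nat \<Rightarrow> nat \<Rightarrow> nat set" where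
  "window m k = {k - mem_size m k..k}"

definition best_index :: "nat \<Rightarrow> (real^'n \<Rightarrow> real^'n) \<Rightarrow> (nat \<Rightarrow> real^'n) \<Rightarrow> nat \<Rightarrow> nat" where
  "best_index m g x k =
     Max {i \<in> window m k. \<forall>j\<in>window m k. norm (residual g (x i)) \<le> norm (residual g (x j))}"

definition coeff_space :: "nat \<Rightarrow> nat \<Rightarrow> (nat \<Rightarrow> real) set" where
  "coeff_space m k = {1..mem_size m k} \<rightarrow>\<^sub>E UNIV"

definition coeff_norm2 :: "nat \<Rightarrow> nat \<Rightarrow> (nat \<Rightarrow> real) \<Rightarrow> real" where
  "coeff_norm2 m k a = L2_set a {1..mem_size m k}"

text \<open>The inserted \<open>0\<close> only matters for the zero-dimensional case \<open>m\<^sub>k = 0\<close>.\<close>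

definition coeff_norm_inf :: "nat \<Rightarrow> nat \<Rightarrow> (nat \<Rightarrow> real) \<Rightarrow> real" where
  "coeff_norm_inf m k a = Max (insert 0 ((\<lambda>i. \<bar>a i\<bar>) ` {1..mem_size m k}))"

definition f_hat ::
  "nat \<Rightarrow> (real^'n \<Rightarrow> real^'n) \<Rightarrow> (nat \<Rightarrow> real^'n) \<Rightarrow> (nat \<Rightarrow> nat \<Rightarrow> nat) \<Rightarrow> nat \<Rightarrow> (nat \<Rightarrow> real) \<Rightarrow> real^'n"
where
  "f_hat m g x idx k a = residual g (x (idx k 0)) +
     (\<Sum>i=1..mem_size m k. a i *\<^sub>R (residual g (x (idx k i)) - residual g (x (idx k 0))))"

definition g_hat ::
  "nat \<Rightarrow> (real^'n \<Rightarrow> real^'n) \<Rightarrow> (nat \<Rightarrow> real^'n) \<Rightarrow> (nat \<Rightarrow> nat \<Rightarrow> nat) \<Rightarrow> nat \<Rightarrow> (nat \<Rightarrow> real) \<Rightarrow> real^'n"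
where
  "g_hat m g x idx k a = g (x (idx k 0)) +
     (\<Sum>i=1..mem_size m k. a i *\<^sub>R (g (x (idx k i)) - g (x (idx k 0))))"

definition r_val ::
  "nat \<Rightarrow> real \<Rightarrow> (real^'n \<Rightarrow> real^'n) \<Rightarrow> (nat \<Rightarrow> real^'n) \<Rightarrow> (nat \<Rightarrow> nat \<Rightarrow> nat) \<Rightarrow> nat \<Rightarrow> real"
where
  "r_val m \<gamma> g x idx k =
     (1 - real (mem_size m k) * \<gamma>) * norm (residual g (x (idx k 0))) +
     \<gamma> * (\<Sum>i=1..mem_size m k. norm (residual g (x (idx k i))))"

definition ared ::
  "nat \<Rightarrow> real \<Rightarrow> (real^'n \<Rightarrow> real^'n) \<Rightarrow> (nat \<Rightarrow> real^'n) \<Rightarrow> (nat \<Rightarrow> nat \<Rightarrow> nat) \<Rightarrow>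
   (nat \<Rightarrow> nat \<Rightarrow> real) \<Rightarrow> nat \<Rightarrow> real"
where
  "ared m \<gamma> g x idx \<alpha> k =
     r_val m \<gamma> g x idx k - norm (residual g (g_hat m g x idx k (\<alpha> k)))"

definition pred ::
  "nat \<Rightarrow> real \<Rightarrow> real \<Rightarrow> (real^'n \<Rightarrow> real^'n) \<Rightarrow> (nat \<Rightarrow> real^'n) \<Rightarrow> (nat \<Rightarrow> nat \<Rightarrow> nat) \<Rightarrow>
   (nat \<Rightarrow> nat \<Rightarrow> real) \<Rightarrow> nat \<Rightarrow> real"
where
  "pred m \<gamma> c g x idx \<alpha> k =
     r_val m \<gamma> g x idx k - c * norm (f_hat m g x idx k (\<alpha> k))"

definition rho ::
  "nat \<Rightarrow> real \<Rightarrow> real \<Rightarrow> (real^'n \<Rightarrow> real^'n) \<Rightarrow> (nat \<Rightarrow> real^'n) \<Rightarrow> (nat \<Rightarrow> nat \<Rightarrow> nat) \<Rightarrow>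
   (nat \<Rightarrow> nat \<Rightarrow> real) \<Rightarrow> nat \<Rightarrow> real"
where
  "rho m \<gamma> c g x idx \<alpha> k = ared m \<gamma> g x idx \<alpha> k / pred m \<gamma> c g x idx \<alpha> k"

definition active :: "(real^'n \<Rightarrow> real^'n) \<Rightarrow> (nat \<Rightarrow> real^'n) \<Rightarrow> nat \<Rightarrow> bool" where
  "active g x k \<longleftrightarrow> (\<forall>i\<le>k. residual g (x i) \<noteq> 0)"

definition terminates :: "(real^'n \<Rightarrow> real^'n) \<Rightarrow> (nat \<Rightarrow> real^'n) \<Rightarrow> bool" where
  "terminates g x \<longleftrightarrow> (\<exists>k. residual g (x k) = 0)"

definition regularized_objective ::
  "nat \<Rightarrow> (real^'n \<Rightarrow> real^'n) \<Rightarrow> (nat \<Rightarrow> real^'n) \<Rightarrow> (nat \<Rightarrow> nat \<Rightarrow> nat) \<Rightarrow> (nat \<Rightarrow> real) \<Rightarrow>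
   nat \<Rightarrow> (nat \<Rightarrow> real) \<Rightarrow> real"
where
  "regularized_objective m g x idx \<mu> k a =
     (norm (f_hat m g x idx k a))\<^sup>2 +
     (\<mu> k * (norm (residual g (x (idx k 0))))\<^sup>2) * (coeff_norm2 m k a)\<^sup>2"

text \<open>
  \<open>LM_AA_run\<close> states that iterates \<open>x\<close>, weights \<open>\<mu>\<close>, index enumerations \<open>idx\<close> and coefficients
  \<open>\<alpha>\<close> form a run of the algorithm. The conditions bind only at active \<open>k\<close>, so after
  termination (the first \<open>k\<close> with zero residual) the sequences are arbitrary.
\<close>

definition LM_AA_run ::
  "(real^'n \<Rightarrow> real^'n) \<Rightarrow> real^'n \<Rightarrow> nat \<Rightarrow> real \<Rightarrow> real \<Rightarrow> real \<Rightarrow> real \<Rightarrow> real \<Rightarrow> real \<Rightarrow> real \<Rightarrow>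
   (nat \<Rightarrow> real^'n) \<Rightarrow> (nat \<Rightarrow> real) \<Rightarrow> (nat \<Rightarrow> nat \<Rightarrow> nat) \<Rightarrow> (nat \<Rightarrow> nat \<Rightarrow> real) \<Rightarrow> bool"
where
  "LM_AA_run g x0 m \<mu>0 p1 p2 \<eta>1 \<eta>2 c \<gamma> x \<mu> idx \<alpha> \<longleftrightarrow>
     x 0 = x0 \<and> \<mu> 0 = \<mu>0 \<and>
     (\<forall>k. active g x k \<longrightarrow>
        idx k 0 = best_index m g x k \<and>
        bij_betw (idx k) {1..mem_size m k} (window m k - {best_index m g x k}) \<and>
        is_arg_min (regularized_objective m g x idx \<mu> k) (\<lambda>a. a \<in> coeff_space m k) (\<alpha> k) \<and>
        \<mu> (Suc k) = (if rho m \<gamma> c g x idx \<alpha> k < p1 then \<eta>1 * \<mu> k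
                     else if rho m \<gamma> c g x idx \<alpha> k \<le> p2 then \<mu> k
                     else \<eta>2 * \<mu> k) \<and>
        x (Suc k) = (if rho m \<gamma> c g x idx \<alpha> k \<ge> p1 then g_hat m g x idx k (\<alpha> k)
                     else g (x (idx k 0))))"

end

theory Submission
  imports Defs
begin

text \<open>
  Comparing the minimizer of the regularized problem with an unregularized one shows that the former
  has the smaller Euclidean norm, so the coefficients \<open>\<alpha> k\<close> stay bounded. The acceptance test and
  the fallback step both contract the residual relative to the largest residual in the window, hence
  the residuals tend to \<open>0\<close> and \<open>x \<longlonglongrightarrow> xstar\<close>. Since \<open>g\<close> is differentiable at \<open>xstar\<close>, it commutes
  with affine combinations with bounded coefficients up to an error \<open>o(r_val)\<close>; therefore the
  residual at \<open>g_hat\<close> is at most \<open>\<kappa> * norm f_hat + o(r_val)\<close>, and \<open>\<kappa> \<le> c < 1\<close> makes \<open>rho \<ge> p2\<close>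
  eventually.
\<close>

section \<open>Sequences contracting over a sliding window\<close>

text \<open>Such a sequence need not be monotone, but once a bound holds on a full window, every
  later term gains a factor \<theta>, so each stretch of \<open>m + 1\<close> indices contributes
  one more power of \<theta>. Quantifying \<open>contr\<close> over every upper bound
  \<open>C\<close> avoids naming the maximum over the window.\<close>

lemma windowed_contraction_tendsto_0:
  fixes u :: "nat \<Rightarrow> real"
  assumes nonneg: "\<And>k. 0 \<le> u k" and \<theta>: "0 \<le> \<theta>" "\<theta> < 1"
    and contr: "\<And>k C. (\<And>i. i \<in> {k - m..k} \<Longrightarrow> u i \<le> C) \<Longrightarrow> u (Suc k) \<le> \<theta> * C"
  shows "u \<longlonglongrightarrow> 0"
proof -
  have bounded: "u k \<le> u 0" for k
  proof (induction k rule: less_induct)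
    case (less k)
    show ?case
    proof (cases k)
      case (Suc j)
      have "u (Suc j) \<le> \<theta> * u 0"
        using less Suc by (intro contr) auto
      also have "\<dots> \<le> 1 * u 0"
        using \<theta> nonneg by (intro mult_right_mono) auto
      finally show ?thesis using Suc by simp
    qed simp
  qed
  \<comment> \<open>Induction on the number of factors: if a bound holds from \<open>N\<close> on,
    the window of any \<open>j \<ge> N + m\<close> lies entirely beyond \<open>N\<close>, so the
    improved bound holds from \<open>Suc (N + m)\<close> on.\<close>
  have geometric: "\<exists>N. \<forall>k\<ge>N. u k \<le> \<theta> ^ n * u 0" for n
  proof (induction n)
    case 0
    then show ?case using bounded by simp
  next
    case (Suc n)
    then obtain N where N: "\<And>k. k \<ge> N \<Longrightarrow> u k \<le> \<theta> ^ n * u 0" by blast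
    have "u k \<le> \<theta> ^ Suc n * u 0" if k: "k \<ge> Suc (N + m)" for k
    proof -
      obtain j where j: "k = Suc j" "j \<ge> N + m"
        using k by (cases k) auto
      have "u (Suc j) \<le> \<theta> * (\<theta> ^ n * u 0)"
        using j by (intro contr N) auto
      then show ?thesis using j by (simp add: mult.assoc)
    qed
    then show ?case by blast
  qed
  have "(\<lambda>n. \<theta> ^ n * u 0) \<longlonglongrightarrow> 0"
    using \<theta> by (intro tendsto_mult_left_zero LIMSEQ_realpow_zero) auto
  show ?thesis
  proof (rule LIMSEQ_I)
    fix e :: real assume "0 < e"
    then have "\<forall>\<^sub>F n in sequentially. \<theta> ^ n * u 0 < e"
      by (intro order_tendstoD(2)[OF \<open>(\<lambda>n. \<theta> ^ n * u 0) \<longlonglongrightarrow> 0\<close>])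
    then obtain n where "\<theta> ^ n * u 0 < e"
      by (auto simp: eventually_sequentially)
    moreover obtain N where "\<forall>k\<ge>N. u k \<le> \<theta> ^ n * u 0" using geometric by blast
    ultimately have "\<forall>k\<ge>N. norm (u k - 0) < e" using nonneg by fastforce
    then show "\<exists>N. \<forall>k\<ge>N. norm (u k - 0) < e" by blast
  qed
qed

section \<open>Affine combinations and differentiability\<close>

text \<open>Brings \<open>f_hat\<close> and \<open>g_hat\<close> into a common form, with the same
  weights of total 1; the weight of the anchor \<open>v 0\<close> absorbs what the others
  leave.\<close>

lemma sum_anchored_eq_affine_combination:
  fixes v :: "nat \<Rightarrow> 'a::real_vector"
  shows "v 0 + (\<Sum>i=1..n. a i *\<^sub>R (v i - v 0)) =
    (\<Sum>j\<le>n. (if j = 0 then 1 - (\<Sum>i=1..n. a i) else a j) *\<^sub>R v j)"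
proof -
  have "(\<Sum>j\<le>n. (if j = 0 then 1 - (\<Sum>i=1..n. a i) else a j) *\<^sub>R v j) =
      (1 - (\<Sum>i=1..n. a i)) *\<^sub>R v 0 + (\<Sum>i=1..n. a i *\<^sub>R v i)"
    by (simp add: atMost_atLeast0 sum.atLeast_Suc_atMost)
  then show ?thesis
    by (simp add: scaleR_diff_right scaleR_diff_left sum_subtractf scaleR_sum_left)
qed

text \<open>The affine part of \<open>g\<close> at \<open>p\<close> commutes exactly with
  combinations of total weight 1, so only first-order remainders survive: those at the points
  \<open>y j\<close> and the one at their combination, which lies within \<open>B * D\<close> of
  \<open>p\<close>. The radius \<delta> is uniform in the weights and points, as both vary with the
  iteration.\<close>

lemma differentiable_affine_combination_error:
  fixes g :: "'a::real_normed_vector \<Rightarrow> 'b::real_normed_vector"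
  assumes "g differentiable (at p)" and "0 < e" and "1 \<le> B"
  shows "\<exists>\<delta>>0. \<forall>(J :: 'i set) w y D. (\<Sum>j\<in>J. w j) = 1 \<longrightarrow> (\<Sum>j\<in>J. \<bar>w j\<bar>) \<le> B \<longrightarrow>
      (\<forall>j\<in>J. norm (y j - p) \<le> D) \<longrightarrow> D < \<delta> \<longrightarrow>
      norm ((\<Sum>j\<in>J. w j *\<^sub>R g (y j)) - g (\<Sum>j\<in>J. w j *\<^sub>R y j)) \<le> e * D"
proof -
  obtain G where G: "(g has_derivative G) (at p)"
    using assms(1) unfolding differentiable_def by blast
  interpret G: bounded_linear G using G by (rule has_derivative_bounded_linear)
  \<comment> \<open>The weighted remainders at the \<open>y j\<close> and the remainder at
    \<open>z\<close> are each at most \<open>e' * B * D\<close>, that is, half of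
    \<open>e * D\<close>.\<close>
  define e' where "e' = e / (2 * B)"
  have "0 < e'" using assms by (simp add: e'_def)
  then obtain d where "0 < d" and
    d: "\<And>y. norm (y - p) < d \<Longrightarrow> norm (g y - g p - G (y - p)) \<le> e' * norm (y - p)"
    using G unfolding has_derivative_at_alt by blast
  define R where "R y = g y - g p - G (y - p)" for y
  have main: "norm ((\<Sum>j\<in>J. w j *\<^sub>R g (y j)) - g (\<Sum>j\<in>J. w j *\<^sub>R y j)) \<le> e * D"
    if w: "(\<Sum>j\<in>J. w j) = 1" "(\<Sum>j\<in>J. \<bar>w j\<bar>) \<le> B"
      and y: "\<And>j. j \<in> J \<Longrightarrow> norm (y j - p) \<le> D" and D: "D < d / B"
    for J :: "'i set" and w y D
  proof -
    define z where "z = (\<Sum>j\<in>J. w j *\<^sub>R y j)"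
    \<comment> \<open>An empty sum could not be 1; a point of \<open>J\<close> then forces
      \<open>D\<close> to be nonnegative.\<close>
    have "J \<noteq> {}" using w(1) by auto
    then have "0 \<le> D" using y by (meson all_not_in_conv norm_ge_zero order_trans)
    then have DB: "D \<le> B * D" using assms(3) mult_right_mono[of 1 B D] by simp
    have "B * D < d" using D assms(3) by (simp add: field_simps)
    have weighted: "(\<Sum>j\<in>J. \<bar>w j\<bar> * t j) \<le> B * T" if "\<And>j. j \<in> J \<Longrightarrow> t j \<le> T" "0 \<le> T" for t T
    proof -
      have "(\<Sum>j\<in>J. \<bar>w j\<bar> * t j) \<le> (\<Sum>j\<in>J. \<bar>w j\<bar>) * T"
        unfolding sum_distrib_right using that by (intro sum_mono mult_left_mono) auto
      also have "\<dots> \<le> B * T" using w(2) that(2) by (rule mult_right_mono)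
      finally show ?thesis .
    qed
    have zp: "z - p = (\<Sum>j\<in>J. w j *\<^sub>R (y j - p))"
      using w(1) by (simp add: z_def scaleR_diff_right sum_subtractf flip: scaleR_sum_left)
    have "norm (z - p) \<le> (\<Sum>j\<in>J. \<bar>w j\<bar> * norm (y j - p))"
      unfolding zp by (rule order_trans[OF norm_sum]) simp
    also have "\<dots> \<le> B * D" using y \<open>0 \<le> D\<close> by (rule weighted)
    finally have z: "norm (z - p) \<le> B * D" .
    have Rz: "norm (R z) \<le> e' * (B * D)"
    proof -
      have "norm (R z) \<le> e' * norm (z - p)"
        unfolding R_def using z \<open>B * D < d\<close> by (intro d) simp
      also have "\<dots> \<le> e' * (B * D)" using z \<open>0 < e'\<close> by simp
      finally show ?thesis .
    qed
    have Ry: "norm (R (y j)) \<le> e' * D" if "j \<in> J" for j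
    proof -
      have "norm (R (y j)) \<le> e' * norm (y j - p)"
        unfolding R_def using y[OF that] DB \<open>B * D < d\<close> by (intro d) simp
      also have "\<dots> \<le> e' * D" using y[OF that] \<open>0 < e'\<close> by simp
      finally show ?thesis .
    qed
    have "G (z - p) = (\<Sum>j\<in>J. w j *\<^sub>R G (y j - p))"
      unfolding zp by (simp only: G.sum G.scaleR)
    then have "(\<Sum>j\<in>J. w j *\<^sub>R R (y j)) = (\<Sum>j\<in>J. w j *\<^sub>R g (y j)) - g p - G (z - p)"
      using w(1) unfolding R_def
      by (simp add: scaleR_diff_right sum_subtractf flip: scaleR_sum_left)
    then have "(\<Sum>j\<in>J. w j *\<^sub>R g (y j)) - g z = (\<Sum>j\<in>J. w j *\<^sub>R R (y j)) - R z"
      by (simp add: R_def)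
    also have "norm \<dots> \<le> norm (\<Sum>j\<in>J. w j *\<^sub>R R (y j)) + norm (R z)"
      by (rule norm_triangle_ineq4)
    also have "norm (\<Sum>j\<in>J. w j *\<^sub>R R (y j)) \<le> (\<Sum>j\<in>J. \<bar>w j\<bar> * norm (R (y j)))"
      by (rule order_trans[OF norm_sum]) simp
    also have "\<dots> \<le> B * (e' * D)"
      using Ry \<open>0 \<le> D\<close> \<open>0 < e'\<close> by (intro weighted) auto
    also have "B * (e' * D) + norm (R z) \<le> e * D"
      using Rz assms(3) by (simp add: e'_def field_simps)
    finally show ?thesis by (simp add: z_def)
  qed
  show ?thesis
    using \<open>0 < d\<close> assms(3) by (intro exI[of _ "d / B"] conjI allI impI main) auto
qed

section \<open>Residuals of a contraction\<close>

lemma norm_residual_contraction_step: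
  assumes "\<kappa>-lipschitz_on UNIV g"
  shows "norm (residual g (g y)) \<le> \<kappa> * norm (residual g y)"
  using lipschitz_onD[OF assms, of "g y" y] by (simp add: residual_def dist_norm)

text \<open>Error bound converting small residuals into closeness to the fixed point:
  \<open>y - p\<close> is \<open>g y - g p\<close> minus the residual, and the Lipschitz term is
  absorbed on the left.\<close>

lemma norm_diff_fixed_point_le_residual:
  assumes "\<kappa>-lipschitz_on UNIV g" and "g p = p"
  shows "(1 - \<kappa>) * norm (y - p) \<le> norm (residual g y)"
proof -
  have "norm (y - p) \<le> norm (g y - g p) + norm (residual g y)"
    using norm_triangle_ineq4[of "g y - g p" "residual g y"] assms(2)
    by (simp add: residual_def)
  then show ?thesis
    using lipschitz_onD[OF assms(1), of y p] by (simp add: dist_norm left_diff_distrib)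
qed

section \<open>Window, coefficients and the least-squares problems\<close>

lemma window_eq: "window m k = {k - m..k}"
  by (auto simp: window_def mem_size_def)

lemma best_index:
  shows best_index_in_window: "best_index m g x k \<in> window m k"
    and best_index_minimal: "j \<in> window m k \<Longrightarrow>
      norm (residual g (x (best_index m g x k))) \<le> norm (residual g (x j))"
proof -
  let ?S = "{i \<in> window m k. \<forall>j\<in>window m k. norm (residual g (x i)) \<le> norm (residual g (x j))}"
  have fin: "finite (window m k)" and ne: "window m k \<noteq> {}"
    by (auto simp: window_def)
  from ex_is_arg_min_if_finite[OF this, of "\<lambda>i. norm (residual g (x i))"]
  have "?S \<noteq> {}" by (auto simp: is_arg_min_linorder)
  then have "best_index m g x k \<in> ?S"
    unfolding best_index_def using fin by (intro Max_in) auto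
  then show "best_index m g x k \<in> window m k"
    and "j \<in> window m k \<Longrightarrow>
      norm (residual g (x (best_index m g x k))) \<le> norm (residual g (x j))"
    by auto
qed

lemma abs_le_coeff_norm_inf:
  assumes "i \<in> {1..mem_size m k}"
  shows "\<bar>a i\<bar> \<le> coeff_norm_inf m k a"
  unfolding coeff_norm_inf_def using assms by (intro Max_ge) auto

text \<open>Passing through the 1-norm is crude, but the factor \<open>m\<close> does not depend on
  \<open>k\<close>.\<close>

lemma coeff_norm2_le_norm_inf:
  assumes "coeff_norm_inf m k a \<le> M"
  shows "coeff_norm2 m k a \<le> real m * M"
proof -
  have M: "\<bar>a i\<bar> \<le> M" if "i \<in> {1..mem_size m k}" for i
    using abs_le_coeff_norm_inf[OF that] assms by (rule order_trans)
  \<comment> \<open>The inserted \<open>0\<close> in the maximum gives this even when there are no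
    coefficients.\<close>
  have "0 \<le> M"
    using assms by (auto simp: coeff_norm_inf_def)
  have "coeff_norm2 m k a \<le> (\<Sum>i=1..mem_size m k. \<bar>a i\<bar>)"
    unfolding coeff_norm2_def by (rule L2_set_le_sum_abs)
  also have "\<dots> \<le> real (mem_size m k) * M"
    using sum_bounded_above[of "{1..mem_size m k}", OF M] by simp
  also have "\<dots> \<le> real m * M"
    using \<open>0 \<le> M\<close> by (intro mult_right_mono) (auto simp: mem_size_def)
  finally show ?thesis .
qed

text \<open>Since \<open>b\<close> has the better fit and \<open>a\<close> the better total,
  \<open>a\<close> cannot have the larger penalty; the penalty weight is positive and
  cancels.\<close>

lemma regularized_coeff_norm_le:
  assumes "is_arg_min (regularized_objective m g x idx \<mu> k) (\<lambda>a. a \<in> coeff_space m k) a"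
    and "is_arg_min (\<lambda>a. (norm (f_hat m g x idx k a))\<^sup>2) (\<lambda>a. a \<in> coeff_space m k) b"
    and "0 < \<mu> k" and "residual g (x (idx k 0)) \<noteq> 0"
  shows "coeff_norm2 m k a \<le> coeff_norm2 m k b"
proof -
  let ?l = "\<mu> k * (norm (residual g (x (idx k 0))))\<^sup>2"
  have mem: "a \<in> coeff_space m k" "b \<in> coeff_space m k"
    using assms by (auto simp: is_arg_min_def)
  have "(norm (f_hat m g x idx k a))\<^sup>2 + ?l * (coeff_norm2 m k a)\<^sup>2
      \<le> (norm (f_hat m g x idx k b))\<^sup>2 + ?l * (coeff_norm2 m k b)\<^sup>2"
    using assms(1) mem by (auto simp: is_arg_min_linorder regularized_objective_def)
  moreover have "(norm (f_hat m g x idx k b))\<^sup>2 \<le> (norm (f_hat m g x idx k a))\<^sup>2"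
    using assms(2) mem by (auto simp: is_arg_min_linorder)
  ultimately have "?l * (coeff_norm2 m k a)\<^sup>2 \<le> ?l * (coeff_norm2 m k b)\<^sup>2" by linarith
  moreover have "0 < ?l" using assms by simp
  ultimately have "(coeff_norm2 m k a)\<^sup>2 \<le> (coeff_norm2 m k b)\<^sup>2" by (simp only: mult_le_cancel_left_pos)
  then show ?thesis
    by (rule power2_le_imp_le) (simp add: coeff_norm2_def L2_set_nonneg)
qed

text \<open>Comparison with zero coefficients, where the penalty vanishes and \<open>f_hat\<close>
  is the residual at the anchor.\<close>

lemma norm_f_hat_regularized_le:
  assumes "is_arg_min (regularized_objective m g x idx \<mu> k) (\<lambda>a. a \<in> coeff_space m k) a"
    and "0 \<le> \<mu> k"
  shows "norm (f_hat m g x idx k a) \<le> norm (residual g (x (idx k 0)))"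
proof -
  \<comment> \<open>The restriction makes the zero vector extensional, as \<open>coeff_space\<close>
    requires.\<close>
  define z :: "nat \<Rightarrow> real" where "z = restrict (\<lambda>_. 0) {1..mem_size m k}"
  have "z \<in> coeff_space m k" by (simp add: z_def coeff_space_def)
  then have "regularized_objective m g x idx \<mu> k a \<le> regularized_objective m g x idx \<mu> k z"
    using assms by (auto simp: is_arg_min_linorder)
  moreover have "f_hat m g x idx k z = residual g (x (idx k 0))"
    by (simp add: f_hat_def z_def)
  moreover have "coeff_norm2 m k z = 0"
    by (simp add: coeff_norm2_def z_def L2_set_def)
  ultimately have "(norm (f_hat m g x idx k a))\<^sup>2
      + (\<mu> k * (norm (residual g (x (idx k 0))))\<^sup>2) * (coeff_norm2 m k a)\<^sup>2
      \<le> (norm (residual g (x (idx k 0))))\<^sup>2"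
    by (simp add: regularized_objective_def)
  moreover have "0 \<le> (\<mu> k * (norm (residual g (x (idx k 0))))\<^sup>2) * (coeff_norm2 m k a)\<^sup>2"
    using assms(2) by simp
  ultimately have "(norm (f_hat m g x idx k a))\<^sup>2 \<le> (norm (residual g (x (idx k 0))))\<^sup>2"
    by linarith
  then show ?thesis by (rule power2_le_imp_le) simp
qed

section \<open>The residual at the accelerated point\<close>

text \<open>Let \<open>z\<close> combine the iterates with the weights that \<open>g_hat\<close>
  applies to their images. Then \<open>f_hat\<close> is \<open>g_hat\<close> minus \<open>z\<close>,
  while \<open>g_hat\<close> is nearly \<open>g z\<close> by differentiability. So the residual at
  \<open>g_hat\<close> is close to that at \<open>g z\<close>, which is at most \<kappa> times the
  residual at \<open>z\<close>, itself close to \<open>f_hat\<close>.\<close>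

lemma norm_residual_g_hat_le:
  assumes lip: "\<kappa>-lipschitz_on UNIV g" and "\<kappa> < 1" and "g p = p"
    and "g differentiable (at p)" and "0 < e" and "0 \<le> A"
  shows "\<exists>\<delta>>0. \<forall>x idx k a D. coeff_norm2 m k a \<le> A \<longrightarrow>
      (\<forall>j\<le>mem_size m k. norm (residual g (x (idx k j))) \<le> D) \<longrightarrow> D < \<delta> \<longrightarrow>
      norm (residual g (g_hat m g x idx k a)) \<le> \<kappa> * norm (f_hat m g x idx k a) + e * D"
proof -
  \<comment> \<open>Bounds the absolute weights: the coefficients contribute at most
    \<open>real m * A\<close>, the anchor at most 1 plus the same amount.\<close>
  define B where "B = 1 + 2 * real m * A"
  have "1 \<le> B" using assms by (simp add: B_def)
  have "0 \<le> \<kappa>" using lip by (rule lipschitz_on_nonneg)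
  \<comment> \<open>The factor \<open>1 - \<kappa>\<close> offsets the distance bound
    \<open>D / (1 - \<kappa>)\<close>; the third is needed because the gap between
    \<open>g_hat\<close> and \<open>g z\<close> enters the final estimate three times.\<close>
  define e' where "e' = e * (1 - \<kappa>) / 3"
  have "0 < e'" using assms by (simp add: e'_def)
  obtain d where "0 < d" and
    d: "\<forall>(J :: nat set) w y D. (\<Sum>j\<in>J. w j) = 1 \<longrightarrow> (\<Sum>j\<in>J. \<bar>w j\<bar>) \<le> B \<longrightarrow>
      (\<forall>j\<in>J. norm (y j - p) \<le> D) \<longrightarrow> D < d \<longrightarrow>
      norm ((\<Sum>j\<in>J. w j *\<^sub>R g (y j)) - g (\<Sum>j\<in>J. w j *\<^sub>R y j)) \<le> e' * D"
    using differentiable_affine_combination_error[OF assms(4) \<open>0 < e'\<close> \<open>1 \<le> B\<close>] by blast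
  have main: "norm (residual g (g_hat m g x idx k a)) \<le> \<kappa> * norm (f_hat m g x idx k a) + e * D"
    if a: "coeff_norm2 m k a \<le> A"
      and D: "\<And>j. j \<le> mem_size m k \<Longrightarrow> norm (residual g (x (idx k j))) \<le> D" "D < d * (1 - \<kappa>)"
    for x idx k a D
  proof -
    let ?n = "mem_size m k"
    define w where "w j = (if j = 0 then 1 - (\<Sum>i=1..?n. a i) else a j)" for j
    define z where "z = (\<Sum>j\<le>?n. w j *\<^sub>R x (idx k j))"
    have g_hat: "g_hat m g x idx k a = (\<Sum>j\<le>?n. w j *\<^sub>R g (x (idx k j)))"
      using sum_anchored_eq_affine_combination[of "\<lambda>j. g (x (idx k j))" a ?n]
      by (simp add: g_hat_def w_def)
    have "f_hat m g x idx k a = (\<Sum>j\<le>?n. w j *\<^sub>R residual g (x (idx k j)))"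
      using sum_anchored_eq_affine_combination[of "\<lambda>j. residual g (x (idx k j))" a ?n]
      by (simp add: f_hat_def w_def)
    then have f_hat: "f_hat m g x idx k a = g_hat m g x idx k a - z"
      by (simp add: g_hat z_def residual_def scaleR_diff_right sum_subtractf)
    have split: "(\<Sum>j\<le>?n. h j) = h 0 + (\<Sum>i=1..?n. h i)" for h :: "nat \<Rightarrow> real"
      by (simp add: atMost_atLeast0 sum.atLeast_Suc_atMost)
    have sum_w: "(\<Sum>j\<le>?n. w j) = 1"
      by (simp add: split w_def)
    have "\<bar>a i\<bar> \<le> A" if "i \<in> {1..?n}" for i
      using member_le_L2_set[of "{1..?n}" i "\<lambda>i. \<bar>a i\<bar>"] that a
      by (simp add: coeff_norm2_def L2_set_def)
    then have "(\<Sum>i=1..?n. \<bar>a i\<bar>) \<le> real ?n * A"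
      using sum_bounded_above[of "{1..?n}" "\<lambda>i. \<bar>a i\<bar>" A] by simp
    also have "\<dots> \<le> real m * A"
      using \<open>0 \<le> A\<close> by (intro mult_right_mono) (auto simp: mem_size_def)
    finally have sum_a: "(\<Sum>i=1..?n. \<bar>a i\<bar>) \<le> real m * A" .
    moreover have "\<bar>\<Sum>i=1..?n. a i\<bar> \<le> (\<Sum>i=1..?n. \<bar>a i\<bar>)" by (rule sum_abs)
    moreover have "(\<Sum>j\<le>?n. \<bar>w j\<bar>) = \<bar>1 - (\<Sum>i=1..?n. a i)\<bar> + (\<Sum>i=1..?n. \<bar>a i\<bar>)"
      by (simp add: split w_def)
    ultimately have sum_abs_w: "(\<Sum>j\<le>?n. \<bar>w j\<bar>) \<le> B"
      unfolding B_def by linarith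
    have "norm (x (idx k j) - p) \<le> D / (1 - \<kappa>)" if "j \<le> ?n" for j
      using norm_diff_fixed_point_le_residual[OF lip assms(3), of "x (idx k j)"] D(1)[OF that] assms(2)
      by (simp add: field_simps)
    moreover have "D / (1 - \<kappa>) < d" using D(2) assms(2) by (simp add: field_simps)
    ultimately have "norm (g_hat m g x idx k a - g z) \<le> e' * (D / (1 - \<kappa>))"
      unfolding g_hat z_def using sum_w sum_abs_w by (intro d[rule_format]) auto
    also have "\<dots> = e * D / 3"
      using assms(2) by (simp add: e'_def divide_simps)
    finally have err: "norm (g_hat m g x idx k a - g z) \<le> e * D / 3" .
    let ?y = "g_hat m g x idx k a"
    have "residual g ?y = (g ?y - g (g z)) + residual g (g z) + (g z - ?y)"
      by (simp add: residual_def)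
    then have "norm (residual g ?y) \<le> norm (g ?y - g (g z)) + norm (residual g (g z)) + norm (?y - g z)"
      using norm_triangle_ineq[of "g ?y - g (g z) + residual g (g z)" "g z - ?y"]
        norm_triangle_ineq[of "g ?y - g (g z)" "residual g (g z)"]
      by (simp add: norm_minus_commute)
    moreover have "norm (g ?y - g (g z)) \<le> norm (?y - g z)"
      using lipschitz_onD[OF lip, of ?y "g z"] assms(2) mult_right_mono[of \<kappa> 1 "norm (?y - g z)"]
      by (simp add: dist_norm)
    moreover have "norm (residual g (g z)) \<le> \<kappa> * norm (f_hat m g x idx k a) + norm (?y - g z)"
    proof -
      have "norm (residual g z) \<le> norm (f_hat m g x idx k a) + norm (?y - g z)"
        using norm_triangle_ineq4[of "f_hat m g x idx k a" "?y - g z"]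
        by (simp add: f_hat residual_def)
      then have "\<kappa> * norm (residual g z) \<le> \<kappa> * (norm (f_hat m g x idx k a) + norm (?y - g z))"
        using \<open>0 \<le> \<kappa>\<close> by (rule mult_left_mono)
      moreover have "\<kappa> * norm (?y - g z) \<le> norm (?y - g z)"
        using assms(2) mult_right_mono[of \<kappa> 1 "norm (?y - g z)"] by simp
      ultimately show ?thesis
        using norm_residual_contraction_step[OF lip, of z] by (simp add: distrib_left)
    qed
    ultimately show ?thesis using err by linarith
  qed
  show ?thesis
    using \<open>0 < d\<close> assms(2)
    by (intro exI[of _ "d * (1 - \<kappa>)"] conjI allI impI main) auto
qed

section \<open>The reference value of the acceptance test\<close>

text \<open>By the bound on \<gamma>, \<open>r_val\<close> is a convex combination of the residual
  norms in the window with every weight at least \<gamma>. Hence it lies between their minimum and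
  maximum and dominates \<gamma> times each of them.\<close>

lemma r_val_bounds:
  assumes "0 < \<gamma>" and "\<gamma> < 1 / (real m + 1)"
    and min: "\<And>j. j \<le> mem_size m k \<Longrightarrow>
      norm (residual g (x (idx k 0))) \<le> norm (residual g (x (idx k j)))"
  shows norm_best_residual_le_r_val: "norm (residual g (x (idx k 0))) \<le> r_val m \<gamma> g x idx k"
    and r_val_le: "(\<And>j. j \<le> mem_size m k \<Longrightarrow> norm (residual g (x (idx k j))) \<le> C) \<Longrightarrow>
      r_val m \<gamma> g x idx k \<le> C"
    and norm_residual_le_r_val: "j \<le> mem_size m k \<Longrightarrow>
      \<gamma> * norm (residual g (x (idx k j))) \<le> r_val m \<gamma> g x idx k"
proof -
  let ?n = "mem_size m k"
  define u where "u j = norm (residual g (x (idx k j)))" for j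
  have r: "r_val m \<gamma> g x idx k = (1 - real ?n * \<gamma>) * u 0 + \<gamma> * (\<Sum>i=1..?n. u i)"
    by (simp add: r_val_def u_def)
  have "real ?n * \<gamma> \<le> real m * \<gamma>"
    using assms(1) by (intro mult_right_mono) (auto simp: mem_size_def)
  moreover have "real m * \<gamma> + \<gamma> < 1" using assms(2) by (simp add: field_simps)
  ultimately have weight: "\<gamma> \<le> 1 - real ?n * \<gamma>" "0 \<le> 1 - real ?n * \<gamma>" using assms(1) by linarith+
  have "real ?n * u 0 \<le> (\<Sum>i=1..?n. u i)"
    using sum_bounded_below[of "{1..?n}" "u 0" u] min by (simp add: u_def)
  then have "\<gamma> * (real ?n * u 0) \<le> \<gamma> * (\<Sum>i=1..?n. u i)"
    using assms(1) by (intro mult_left_mono) auto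
  then show "norm (residual g (x (idx k 0))) \<le> r_val m \<gamma> g x idx k"
    unfolding r by (simp add: u_def algebra_simps)
  show "r_val m \<gamma> g x idx k \<le> C"
    if "\<And>j. j \<le> ?n \<Longrightarrow> norm (residual g (x (idx k j))) \<le> C"
  proof -
    have "(\<Sum>i=1..?n. u i) \<le> real ?n * C"
      using sum_bounded_above[of "{1..?n}" u C] that by (simp add: u_def)
    then have "\<gamma> * (\<Sum>i=1..?n. u i) \<le> \<gamma> * (real ?n * C)"
      using assms(1) by (intro mult_left_mono) auto
    moreover have "(1 - real ?n * \<gamma>) * u 0 \<le> (1 - real ?n * \<gamma>) * C"
      using that[of 0] weight(2) by (intro mult_left_mono) (auto simp: u_def)
    ultimately show ?thesis unfolding r by (simp add: algebra_simps)
  qed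
  show "\<gamma> * norm (residual g (x (idx k j))) \<le> r_val m \<gamma> g x idx k" if "j \<le> ?n"
  proof (cases "j = 0")
    case True
    have "\<gamma> * u 0 \<le> (1 - real ?n * \<gamma>) * u 0"
      using weight(1) by (intro mult_right_mono) (auto simp: u_def)
    moreover have "0 \<le> \<gamma> * (\<Sum>i=1..?n. u i)"
      using assms(1) by (intro mult_nonneg_nonneg sum_nonneg) (auto simp: u_def)
    ultimately show ?thesis using True unfolding r by (simp add: u_def)
  next
    case False
    then have "u j \<le> (\<Sum>i=1..?n. u i)"
      using that by (intro member_le_sum) (auto simp: u_def)
    then have "\<gamma> * u j \<le> \<gamma> * (\<Sum>i=1..?n. u i)" using assms(1) by simp
    moreover have "0 \<le> (1 - real ?n * \<gamma>) * u 0"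
      using weight(2) by (intro mult_nonneg_nonneg) (auto simp: u_def)
    ultimately show ?thesis unfolding r by (simp add: u_def)
  qed
qed

section \<open>Convergence and eventual acceptance\<close>

theorem theorem2:
  fixes g :: "real^'n \<Rightarrow> real^'n"
    and x0 xstar :: "real^'n"
    and m :: nat
    and \<kappa> \<mu>0 p1 p2 \<eta>1 \<eta>2 c \<gamma> M :: real
    and x :: "nat \<Rightarrow> real^'n"
    and \<mu> :: "nat \<Rightarrow> real"
    and idx :: "nat \<Rightarrow> nat \<Rightarrow> nat"
    and \<alpha> \<alpha>bar :: "nat \<Rightarrow> nat \<Rightarrow> real"
  assumes "\<kappa>-lipschitz_on UNIV g" and "\<kappa> < 1"
    and "g xstar = xstar" and "g differentiable (at xstar)"
    and "m \<ge> 1" and "\<mu>0 > 0"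
    and "0 < p1" and "p1 < p2" and "p2 < 1"
    and "0 < \<eta>2" and "\<eta>2 < 1" and "1 < \<eta>1"
    and "0 < c" and "c < 1" and "\<kappa> \<le> c"
    and "0 < \<gamma>" and "\<gamma> < 1 / (real m + 1)"
    and "LM_AA_run g x0 m \<mu>0 p1 p2 \<eta>1 \<eta>2 c \<gamma> x \<mu> idx \<alpha>"
    and "\<And>k. active g x k \<Longrightarrow>
           is_arg_min (\<lambda>a. (norm (f_hat m g x idx k a))\<^sup>2) (\<lambda>a. a \<in> coeff_space m k) (\<alpha>bar k)"
    and "M > 0"
    and "\<forall>\<^sub>F k in sequentially. active g x k \<longrightarrow> coeff_norm_inf m k (\<alpha>bar k) \<le> M"
  shows "terminates g x \<or>
    (x \<longlonglongrightarrow> xstar \<and>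
     (\<exists>l. (\<forall>k\<ge>l. rho m \<gamma> c g x idx \<alpha> k \<ge> p2) \<and>
          (\<forall>k\<ge>l. rho m \<gamma> c g x idx \<alpha> k \<ge> p1 \<and> x (Suc k) = g_hat m g x idx k (\<alpha> k))))"
proof (cases "terminates g x")
  case False
  note lip = assms(1)
  note run = assms(18)[unfolded LM_AA_run_def]
  have active: "active g x k" for k
    using False by (auto simp: terminates_def active_def)
  then have nonzero: "residual g (x k) \<noteq> 0" for k
    unfolding active_def by blast
  have "0 \<le> \<kappa>" using lip by (rule lipschitz_on_nonneg)
  have idx0: "idx k 0 = best_index m g x k"
    and idx: "bij_betw (idx k) {1..mem_size m k} (window m k - {best_index m g x k})"
    and arg_min: "is_arg_min (regularized_objective m g x idx \<mu> k) (\<lambda>a. a \<in> coeff_space m k) (\<alpha> k)"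
    and \<mu>_Suc: "\<mu> (Suc k) = (if rho m \<gamma> c g x idx \<alpha> k < p1 then \<eta>1 * \<mu> k
                     else if rho m \<gamma> c g x idx \<alpha> k \<le> p2 then \<mu> k
                     else \<eta>2 * \<mu> k)"
    and x_Suc: "x (Suc k) = (if rho m \<gamma> c g x idx \<alpha> k \<ge> p1 then g_hat m g x idx k (\<alpha> k)
                     else g (x (idx k 0)))" for k
    using run active by blast+
  have \<mu>_pos: "0 < \<mu> k" for k
  proof (induction k)
    case 0
    then show ?case using run \<open>\<mu>0 > 0\<close> by simp
  next
    case (Suc k)
    then show ?case using \<open>0 < \<eta>2\<close> \<open>1 < \<eta>1\<close> by (simp add: \<mu>_Suc)
  qed
  have idx_window: "idx k j \<in> window m k" if "j \<le> mem_size m k" for k j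
  proof (cases "j = 0")
    case True
    then show ?thesis by (simp add: idx0 best_index_in_window)
  next
    case False
    then show ?thesis using bij_betwE[OF idx[of k]] that by auto
  qed
  have min: "norm (residual g (x (idx k 0))) \<le> norm (residual g (x (idx k j)))"
    if "j \<le> mem_size m k" for k j
    unfolding idx0 using idx_window[OF that] by (rule best_index_minimal)
  define r where "r = r_val m \<gamma> g x idx"
  have best_le_r: "norm (residual g (x (idx k 0))) \<le> r k"
    and r_le: "(\<And>j. j \<le> mem_size m k \<Longrightarrow> norm (residual g (x (idx k j))) \<le> C) \<Longrightarrow> r k \<le> C"
    and residual_le_r: "j \<le> mem_size m k \<Longrightarrow> \<gamma> * norm (residual g (x (idx k j))) \<le> r k" for k j C
    unfolding r_def using \<open>0 < \<gamma>\<close> \<open>\<gamma> < 1 / (real m + 1)\<close> min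
    by (blast intro: r_val_bounds)+
  define F where "F k = norm (f_hat m g x idx k (\<alpha> k))" for k
  have F_le: "F k \<le> norm (residual g (x (idx k 0)))" for k
    unfolding F_def using arg_min \<mu>_pos[of k] by (intro norm_f_hat_regularized_le) auto
  have F_le_r: "F k \<le> r k" for k
    using F_le[of k] best_le_r[of k] by linarith
  have r_pos: "0 < r k" for k
  proof -
    have "0 < norm (residual g (x (idx k 0)))" using nonzero by simp
    also have "\<dots> \<le> r k" by (rule best_le_r)
    finally show ?thesis .
  qed
  have cF: "c * F k \<le> c * r k" for k
    using F_le_r \<open>0 < c\<close> by simp
  have pred_pos: "0 < r k - c * F k" for k
    using cF[of k] r_pos[of k] mult_strict_right_mono[OF \<open>c < 1\<close>, of "r k"] by linarith
  \<comment> \<open>The positive denominator turns a threshold on the quotient into a residual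
    bound; used with \<open>p1\<close> for convergence and with \<open>p2\<close> for eventual
    acceptance.\<close>
  have rho_ge_iff: "rho m \<gamma> c g x idx \<alpha> k \<ge> q \<longleftrightarrow>
      norm (residual g (g_hat m g x idx k (\<alpha> k))) \<le> r k - q * (r k - c * F k)" for k q
    using pred_pos[of k]
    by (auto simp: rho_def ared_def pred_def r_def F_def pos_le_divide_eq)

  \<comment> \<open>An accepted step yields exactly this factor once \<open>F k\<close> is replaced
    by \<open>r k\<close>; since \<open>\<kappa> \<le> c \<le> \<theta>\<close>, it also covers the
    fallback step.\<close>
  define \<theta> where "\<theta> = 1 - p1 * (1 - c)"
  have \<theta>: "c \<le> \<theta>" "\<theta> < 1"
  proof -
    have "p1 * (1 - c) \<le> 1 * (1 - c)"
      using \<open>p1 < p2\<close> \<open>p2 < 1\<close> \<open>c < 1\<close> by (intro mult_right_mono) auto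
    then show "c \<le> \<theta>" by (simp add: \<theta>_def)
    show "\<theta> < 1" using \<open>0 < p1\<close> \<open>c < 1\<close> by (simp add: \<theta>_def)
  qed
  define u where "u k = norm (residual g (x k))" for k
  have u_lim: "u \<longlonglongrightarrow> 0"
  proof (rule windowed_contraction_tendsto_0[of u \<theta> m])
    fix k C assume C: "\<And>i. i \<in> {k - m..k} \<Longrightarrow> u i \<le> C"
    then have C': "norm (residual g (x (idx k j))) \<le> C" if "j \<le> mem_size m k" for j
      using idx_window[OF that] by (simp add: window_eq u_def)
    have "0 \<le> C" using C'[of 0] norm_ge_zero order_trans by blast
    show "u (Suc k) \<le> \<theta> * C"
    proof (cases "rho m \<gamma> c g x idx \<alpha> k \<ge> p1")
      case True
      then have "u (Suc k) \<le> r k - p1 * (r k - c * F k)"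
        by (simp add: x_Suc u_def rho_ge_iff)
      also have "\<dots> \<le> r k - p1 * (r k - c * r k)"
        using cF \<open>0 < p1\<close> by simp
      also have "\<dots> = \<theta> * r k" by (simp add: \<theta>_def algebra_simps)
      also have "\<dots> \<le> \<theta> * C"
        using r_le[of k C] C' \<theta> \<open>0 < c\<close> by (intro mult_left_mono) auto
      finally show ?thesis .
    next
      case False
      then have "u (Suc k) \<le> \<kappa> * norm (residual g (x (idx k 0)))"
        using norm_residual_contraction_step[OF lip] by (simp add: x_Suc u_def)
      also have "\<dots> \<le> \<theta> * C"
        using \<theta> \<open>\<kappa> \<le> c\<close> \<open>0 < c\<close> C'[of 0] by (intro mult_mono) auto
      finally show ?thesis .
    qed
  qed (use \<theta> \<open>0 < c\<close> in \<open>auto simp: u_def\<close>)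

  have "norm (x k - xstar) \<le> u k / (1 - \<kappa>)" for k
    using norm_diff_fixed_point_le_residual[OF lip \<open>g xstar = xstar\<close>, of "x k"] \<open>\<kappa> < 1\<close>
    by (simp add: u_def field_simps)
  then have "(\<lambda>k. x k - xstar) \<longlonglongrightarrow> 0"
    by (intro Lim_null_comparison[OF always_eventually tendsto_divide_zero[OF u_lim]]) blast
  then have x_lim: "x \<longlonglongrightarrow> xstar" by (rule LIM_zero_cancel)

  \<comment> \<open>With \<open>D = r k / \<gamma>\<close> the \<gamma> cancels and the error
    becomes \<open>(1 - p2) * (r k - c * r k)\<close>, at most the fraction \<open>1 - p2\<close> of
    the predicted reduction because \<open>F k \<le> r k\<close>.\<close>
  define e where "e = (1 - p2) * (1 - c) * \<gamma>"
  have "0 < e" using \<open>p2 < 1\<close> \<open>c < 1\<close> \<open>0 < \<gamma>\<close> by (simp add: e_def)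
  have "0 \<le> real m * M" using \<open>M > 0\<close> by simp
  obtain \<delta> where "0 < \<delta>" and
    \<delta>: "\<forall>x idx k a D. coeff_norm2 m k a \<le> real m * M \<longrightarrow>
      (\<forall>j\<le>mem_size m k. norm (residual g (x (idx k j))) \<le> D) \<longrightarrow> D < \<delta> \<longrightarrow>
      norm (residual g (g_hat m g x idx k a)) \<le> \<kappa> * norm (f_hat m g x idx k a) + e * D"
    using norm_residual_g_hat_le[OF lip \<open>\<kappa> < 1\<close> \<open>g xstar = xstar\<close> \<open>g differentiable (at xstar)\<close>
        \<open>0 < e\<close> \<open>0 \<le> real m * M\<close>] by blast
  obtain K where K: "\<And>k. k \<ge> K \<Longrightarrow> coeff_norm_inf m k (\<alpha>bar k) \<le> M"
    using assms(21) active by (auto simp: eventually_sequentially)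
  \<comment> \<open>Halving leaves room for the strict bound
    \<open>r k / \<gamma> < \<delta>\<close>, as \<open>r_le\<close> yields only a non-strict
    one.\<close>
  have "0 < \<gamma> * \<delta> / 2" using \<open>0 < \<gamma>\<close> \<open>0 < \<delta>\<close> by simp
  then have "\<forall>\<^sub>F k in sequentially. u k < \<gamma> * \<delta> / 2"
    by (rule order_tendstoD(2)[OF u_lim])
  then obtain N where N: "\<And>k. k \<ge> N \<Longrightarrow> u k < \<gamma> * \<delta> / 2"
    by (auto simp: eventually_sequentially)
  \<comment> \<open>The shift by \<open>m\<close> keeps the whole window of \<open>k\<close> beyond
    \<open>N\<close>.\<close>
  have rho_p2: "rho m \<gamma> c g x idx \<alpha> k \<ge> p2" if "k \<ge> max K (N + m)" for k
  proof -
    have "coeff_norm2 m k (\<alpha> k) \<le> coeff_norm2 m k (\<alpha>bar k)"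
      using arg_min assms(19)[OF active] \<mu>_pos nonzero by (rule regularized_coeff_norm_le)
    also have "\<dots> \<le> real m * M"
      using K that by (intro coeff_norm2_le_norm_inf) auto
    finally have "coeff_norm2 m k (\<alpha> k) \<le> real m * M" .
    \<comment> \<open>Bounding the window through \<open>r k\<close> makes the differentiability
      error comparable with the predicted reduction.\<close>
    moreover have "norm (residual g (x (idx k j))) \<le> r k / \<gamma>" if "j \<le> mem_size m k" for j
      using residual_le_r[OF that] \<open>0 < \<gamma>\<close> by (simp add: field_simps)
    moreover have "r k / \<gamma> < \<delta>"
    proof -
      have "norm (residual g (x (idx k j))) \<le> \<gamma> * \<delta> / 2" if "j \<le> mem_size m k" for j
      proof -
        have "idx k j \<ge> N"
          using idx_window[OF that] \<open>k \<ge> max K (N + m)\<close> by (auto simp: window_eq)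
        then show ?thesis using N[of "idx k j"] by (simp add: u_def)
      qed
      then have "r k \<le> \<gamma> * \<delta> / 2" by (rule r_le)
      also have "\<dots> < \<gamma> * \<delta>" using \<open>0 < \<gamma>\<close> \<open>0 < \<delta>\<close> by simp
      finally show ?thesis using \<open>0 < \<gamma>\<close> by (simp add: field_simps)
    qed
    ultimately have "norm (residual g (g_hat m g x idx k (\<alpha> k))) \<le> \<kappa> * F k + e * (r k / \<gamma>)"
      unfolding F_def by (rule \<delta>[rule_format])
    also have "\<kappa> * F k \<le> c * F k"
      using \<open>\<kappa> \<le> c\<close> by (intro mult_right_mono) (auto simp: F_def)
    also have "e * (r k / \<gamma>) = (1 - p2) * (r k - c * r k)"
      using \<open>0 < \<gamma>\<close> by (simp add: e_def algebra_simps)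
    also have "c * F k + (1 - p2) * (r k - c * r k) \<le> c * F k + (1 - p2) * (r k - c * F k)"
      using cF \<open>p2 < 1\<close> by (intro add_left_mono mult_left_mono) auto
    also have "\<dots> = r k - p2 * (r k - c * F k)" by (simp add: algebra_simps)
    finally show ?thesis unfolding rho_ge_iff by simp
  qed
  have "rho m \<gamma> c g x idx \<alpha> k \<ge> p1 \<and> x (Suc k) = g_hat m g x idx k (\<alpha> k)"
    if "k \<ge> max K (N + m)" for k
    using rho_p2[OF that] \<open>p1 < p2\<close> by (simp add: x_Suc)
  then show ?thesis using x_lim rho_p2 by blast
qed simp

end
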